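(* Let $\{\alpha_i\}_{i=0}^\infty$ be a bounded complex sequence, let $S_\alpha\in\mathcal{B}(\ell^2)$ be the unilateral weighted shift operator with $S_\alpha(e_{i})=\alpha_{i}e_{i+1}$ for all $i\in\mathbb{N}_0$, and let $M=\mathrm{diag}(\mu_{0},\mu_{1},\dots)$ be a bounded diagonal operator on $\ell^{2}$. Assume that $\alpha_{i}\ne 0$ for all $i\in\mathbb{N}_0$. Then: (a) If some $\mu_{i}=0$, then $0\in\sigma_{p}(S_\alpha\odot M)$; otherwise, $S_\alpha\odot M$ is injective. (b) $\sigma_{p}(S_\alpha\odot M)\subseteq\{0\}$.
   Context: $\mathbb{N}_0=\{0,1,2,\dots\}$; $\{e_0,e_1,\dots\}$ is the standard orthonormal basis of the complex Hilbert space $\ell^2$; $\mathcal{B}(\ell^2)$ is the algebra of bounded linear operators on $\ell^2$; $M=\mathrm{diag}(\mu_0,\mu_1,\dots)$ means $Me_i=\mu_ie_i$ with $\{\mu_i\}$ a bounded complex sequence; $\sigma_p(T)$ is the point spectrum (set of eigenvalues) of $T$. For a Hilbert space $\mathcal{H}$, let $\mathcal{H}\otimes\mathcal{H}$ be the Hilbert space tensor product and let $F$ be the flip, the bounded linear map with $F(u\otimes v)=v\otimes u$. Set $\mathcal{H}\odot\mathcal{H}=\{x\in\mathcal{H}\otimes\mathcal{H}:Fx=x\}$. For bounded operators $A,B$ on $\mathcal{H}$, $A\odot B$ is the restriction of $\frac12(A\otimes B+B\otimes A)$ to the invariant subspace $\mathcal{H}\odot\mathcal{H}$. *)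

theory Defs
  imports "HOL-Analysis.Analysis"
begin

section \<open>The complex Hilbert space of square-summable families\<close>

typedef 'a ell2 = "{x :: 'a \<Rightarrow> complex. (\<lambda>i. (cmod (x i))\<^sup>2) summable_on UNIV}"
  morphisms coord Abs_ell2
  by (rule exI[of _ "\<lambda>_. 0"]) simp

lemma coord_summable: "(\<lambda>i. (cmod (coord x i))\<^sup>2) summable_on UNIV"
  using coord[of x] by simp

lemma coord_Abs: "(\<lambda>i. (cmod (f i))\<^sup>2) summable_on UNIV \<Longrightarrow> coord (Abs_ell2 f) = f"
  by (simp add: Abs_ell2_inverse)

lemma ell2_eqI: "(\<And>i. coord x i = coord y i) \<Longrightarrow> x = y"
  by (metis coord_inject ext)

lemma square_summable_add:
  assumes "(\<lambda>i. (cmod (f i))\<^sup>2) summable_on A" "(\<lambda>i. (cmod (g i))\<^sup>2) summable_on A"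
  shows "(\<lambda>i. (cmod (f i + g i))\<^sup>2) summable_on A"
proof (rule summable_on_comparison_test)
  show "(\<lambda>i. 2 * (cmod (f i))\<^sup>2 + 2 * (cmod (g i))\<^sup>2) summable_on A"
    by (intro summable_on_add summable_on_cmult_right assms)
  fix i
  have "(cmod (f i + g i))\<^sup>2 \<le> (cmod (f i) + cmod (g i))\<^sup>2"
    by (intro power_mono norm_triangle_ineq) simp
  also have "\<dots> \<le> 2 * (cmod (f i))\<^sup>2 + 2 * (cmod (g i))\<^sup>2"
    using sum_squares_bound[of "cmod (f i)" "cmod (g i)"] by (simp add: power2_sum)
  finally show "(cmod (f i + g i))\<^sup>2 \<le> 2 * (cmod (f i))\<^sup>2 + 2 * (cmod (g i))\<^sup>2" .
qed simp

lemma square_summable_scale: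
  assumes "(\<lambda>i. (cmod (f i))\<^sup>2) summable_on A"
  shows "(\<lambda>i. (cmod (c * f i))\<^sup>2) summable_on A"
  using summable_on_cmult_right[OF assms, of "(cmod c)\<^sup>2"]
  by (simp add: norm_mult power_mult_distrib)

definition cinner :: "'a ell2 \<Rightarrow> 'a ell2 \<Rightarrow> complex" where
  "cinner x y = (\<Sum>\<^sub>\<infinity>i. coord x i * cnj (coord y i))"

lemma cinner_abs_summable: "(\<lambda>i. norm (coord x i * cnj (coord y i))) summable_on UNIV"
proof (rule summable_on_comparison_test)
  show "(\<lambda>i. (cmod (coord x i))\<^sup>2 + (cmod (coord y i))\<^sup>2) summable_on UNIV"
    by (intro summable_on_add coord_summable)
  fix i
  show "norm (coord x i * cnj (coord y i)) \<le> (cmod (coord x i))\<^sup>2 + (cmod (coord y i))\<^sup>2"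
    using sum_squares_bound[of "cmod (coord x i)" "cmod (coord y i)"]
      mult_nonneg_nonneg[OF norm_ge_zero norm_ge_zero, of "coord x i" "coord y i"]
    unfolding norm_mult complex_mod_cnj mult.assoc by linarith
qed simp

lemma cinner_summable: "(\<lambda>i. coord x i * cnj (coord y i)) summable_on UNIV"
  using cinner_abs_summable by (rule Infinite_Sum.abs_summable_summable)

lemma Re_cinner: "Re (cinner x y) = (\<Sum>\<^sub>\<infinity>i. Re (coord x i * cnj (coord y i)))"
  unfolding cinner_def by (rule infsum_Re[symmetric, OF cinner_summable])

lemma Re_cinner_self: "Re (cinner x x) = (\<Sum>\<^sub>\<infinity>i. (cmod (coord x i))\<^sup>2)"
  unfolding Re_cinner by (intro infsum_cong) (simp add: complex_mult_cnj cmod_power2)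

instantiation ell2 :: (type) real_vector
begin

definition "0 = Abs_ell2 (\<lambda>_. 0)"
definition "x + y = Abs_ell2 (\<lambda>i. coord x i + coord y i)"
definition "- x = Abs_ell2 (\<lambda>i. - coord x i)" for x :: "'a ell2"
definition "x - y = Abs_ell2 (\<lambda>i. coord x i - coord y i)"
definition "r *\<^sub>R x = Abs_ell2 (\<lambda>i. complex_of_real r * coord x i)"

lemma coord_zero [simp]: "coord 0 i = 0"
  by (simp add: zero_ell2_def coord_Abs)

lemma coord_add [simp]: "coord (x + y) i = coord x i + coord y i"
  by (simp add: plus_ell2_def coord_Abs square_summable_add coord_summable)

lemma coord_uminus [simp]: "coord (- x) i = - coord x i"
  by (simp add: uminus_ell2_def coord_Abs coord_summable)

lemma coord_diff [simp]: "coord (x - y) i = coord x i - coord y i"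
proof -
  have "(\<lambda>i. (cmod (coord x i + - coord y i))\<^sup>2) summable_on UNIV"
    by (intro square_summable_add) (simp_all add: coord_summable)
  then show ?thesis
    by (simp add: minus_ell2_def coord_Abs)
qed

lemma coord_scaleR [simp]: "coord (r *\<^sub>R x) i = complex_of_real r * coord x i"
  by (simp only: scaleR_ell2_def coord_Abs square_summable_scale coord_summable)

instance
  by standard (rule ell2_eqI; simp add: algebra_simps)+

end

instantiation ell2 :: (type) real_inner
begin

definition "x \<bullet> y = Re (cinner x y)"
definition "norm x = sqrt (x \<bullet> x)" for x :: "'a ell2"
definition "dist x y = norm (x - y)" for x y :: "'a ell2"
definition "sgn x = x /\<^sub>R norm x" for x :: "'a ell2"
definition [code del]:
  "(uniformity :: ('a ell2 \<times> 'a ell2) filter) = (INF e\<in>{0<..}. principal {(x, y). dist x y < e})"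
definition [code del]:
  "open (U :: 'a ell2 set) \<longleftrightarrow> (\<forall>x\<in>U. eventually (\<lambda>(x', y). x' = x \<longrightarrow> y \<in> U) uniformity)"

instance
proof
  fix x y z :: "'a ell2" and r :: real
  show "dist x y = norm (x - y)" by (fact dist_ell2_def)
  show "sgn x = x /\<^sub>R norm x" by (fact sgn_ell2_def)
  show "uniformity = (INF e\<in>{0<..}. principal {(x :: 'a ell2, y). dist x y < e})"
    by (fact uniformity_ell2_def)
  show "open U \<longleftrightarrow> (\<forall>x\<in>U. eventually (\<lambda>(x', y). x' = x \<longrightarrow> y \<in> U) uniformity)"
    for U :: "'a ell2 set"
    by (fact open_ell2_def)
  show "x \<bullet> y = y \<bullet> x"
    unfolding inner_ell2_def Re_cinner by (intro infsum_cong) simp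
  have "cinner (x + y) z = cinner x z + cinner y z"
    unfolding cinner_def using infsum_add[OF cinner_summable cinner_summable, of x z y z]
    by (simp add: algebra_simps)
  then show "(x + y) \<bullet> z = x \<bullet> z + y \<bullet> z"
    by (simp add: inner_ell2_def)
  have "cinner (r *\<^sub>R x) y = complex_of_real r * cinner x y"
    unfolding cinner_def by (simp add: infsum_cmult_right' mult.assoc)
  then show "r *\<^sub>R x \<bullet> y = r * (x \<bullet> y)"
    by (simp add: inner_ell2_def)
  show nonneg: "0 \<le> x \<bullet> x"
    unfolding inner_ell2_def Re_cinner_self by (simp add: infsum_nonneg)
  show "x \<bullet> x = 0 \<longleftrightarrow> x = 0"
  proof
    assume "x \<bullet> x = 0"
    then have "(cmod (coord x i))\<^sup>2 = 0" for i
      using nonneg_infsum_le_0D[OF _ coord_summable[of x], of i]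
      by (simp add: inner_ell2_def Re_cinner_self)
    then show "x = 0" by (intro ell2_eqI) simp
  qed (simp add: inner_ell2_def cinner_def)
  show "norm x = sqrt (x \<bullet> x)" by (fact norm_ell2_def)
qed

end

lemma norm_ell2_square: "(norm x)\<^sup>2 = (\<Sum>\<^sub>\<infinity>i. (cmod (coord x i))\<^sup>2)"
  by (simp add: power2_norm_eq_inner inner_ell2_def Re_cinner_self)

lemma sum_coord_le_norm:
  assumes "finite F"
  shows "(\<Sum>i\<in>F. (cmod (coord x i))\<^sup>2) \<le> (norm x)\<^sup>2"
  unfolding norm_ell2_square
  by (rule finite_sum_le_infsum) (use assms in \<open>auto simp: coord_summable\<close>)

lemma coord_le_norm: "cmod (coord x i) \<le> norm x"
proof -
  have "(cmod (coord x i))\<^sup>2 \<le> (norm x)\<^sup>2"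
    using sum_coord_le_norm[of "{i}" x] by simp
  then show ?thesis
    by (rule power2_le_imp_le) simp
qed

lemma ell2_boundI:
  assumes "\<And>F. finite F \<Longrightarrow> (\<Sum>i\<in>F. (cmod (f i))\<^sup>2) \<le> C\<^sup>2" and "0 \<le> C"
  shows "(\<lambda>i. (cmod (f i))\<^sup>2) summable_on UNIV" and "norm (Abs_ell2 f) \<le> C"
proof -
  show s: "(\<lambda>i. (cmod (f i))\<^sup>2) summable_on UNIV"
    by (rule nonneg_bdd_above_summable_on)
      (use assms in \<open>auto simp: bdd_above_def intro!: exI[of _ "C\<^sup>2"]\<close>)
  have "(norm (Abs_ell2 f))\<^sup>2 \<le> C\<^sup>2"
    unfolding norm_ell2_square coord_Abs[OF s]
    by (rule infsum_le_finite_sums[OF s]) (use assms in auto)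
  then show "norm (Abs_ell2 f) \<le> C"
    using assms(2) by (rule power2_le_imp_le)
qed

instance ell2 :: (type) banach
proof
  fix X :: "nat \<Rightarrow> 'a ell2"
  assume "Cauchy X"
  have "Cauchy (\<lambda>n. coord (X n) i)" for i
  proof (rule metric_CauchyI)
    fix e :: real assume "0 < e"
    then obtain N where N: "\<And>m n. m \<ge> N \<Longrightarrow> n \<ge> N \<Longrightarrow> dist (X m) (X n) < e"
      using metric_CauchyD[OF \<open>Cauchy X\<close>] by blast
    have "dist (coord (X m) i) (coord (X n) i) < e" if "m \<ge> N" "n \<ge> N" for m n
      using coord_le_norm[of "X m - X n" i] N[OF that] by (simp add: dist_norm)
    then show "\<exists>N. \<forall>m\<ge>N. \<forall>n\<ge>N. dist (coord (X m) i) (coord (X n) i) < e" by blast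
  qed
  then have "\<forall>i. \<exists>l. (\<lambda>n. coord (X n) i) \<longlonglongrightarrow> l"
    by (auto simp: Cauchy_convergent_iff convergent_def)
  then obtain f where f: "\<And>i. (\<lambda>n. coord (X n) i) \<longlonglongrightarrow> f i" by metis
  have close: "(\<Sum>i\<in>F. (cmod (coord (X n) i - f i))\<^sup>2) \<le> e\<^sup>2"
    if N: "\<And>m n. m \<ge> N \<Longrightarrow> n \<ge> N \<Longrightarrow> dist (X m) (X n) < e" and "n \<ge> N" "finite F" for N n e F
  proof (rule tendsto_upperbound[of _ _ sequentially])
    show "(\<lambda>m. \<Sum>i\<in>F. (cmod (coord (X n) i - coord (X m) i))\<^sup>2)
            \<longlonglongrightarrow> (\<Sum>i\<in>F. (cmod (coord (X n) i - f i))\<^sup>2)"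
      by (intro tendsto_intros f)
    have "(\<Sum>i\<in>F. (cmod (coord (X n) i - coord (X m) i))\<^sup>2) \<le> e\<^sup>2" if "m \<ge> N" for m
    proof -
      have "(\<Sum>i\<in>F. (cmod (coord (X n - X m) i))\<^sup>2) \<le> (norm (X n - X m))\<^sup>2"
        using \<open>finite F\<close> by (rule sum_coord_le_norm)
      also have "\<dots> \<le> e\<^sup>2"
        using N[OF \<open>n \<ge> N\<close> that] by (intro power_mono) (auto simp: dist_norm)
      finally show ?thesis by simp
    qed
    then show "\<forall>\<^sub>F m in sequentially. (\<Sum>i\<in>F. (cmod (coord (X n) i - coord (X m) i))\<^sup>2) \<le> e\<^sup>2"
      by (auto simp: eventually_sequentially)
  qed simp
  have f_summable: "(\<lambda>i. (cmod (f i))\<^sup>2) summable_on UNIV"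
  proof -
    obtain N where N: "\<And>m n. m \<ge> N \<Longrightarrow> n \<ge> N \<Longrightarrow> dist (X m) (X n) < 1"
      using metric_CauchyD[OF \<open>Cauchy X\<close>, of 1] by auto
    have "(\<lambda>i. (cmod (coord (X N) i - f i))\<^sup>2) summable_on UNIV"
      by (rule ell2_boundI(1)[of _ 1]) (use close[OF N] in auto)
    then have "(\<lambda>i. (cmod (coord (X N) i + (-1) * (coord (X N) i - f i)))\<^sup>2) summable_on UNIV"
      by (intro square_summable_add square_summable_scale coord_summable)
    then show ?thesis by simp
  qed
  have "X \<longlonglongrightarrow> Abs_ell2 f"
  proof (rule metric_LIMSEQ_I)
    fix e :: real assume "0 < e"
    then obtain N where N: "\<And>m n. m \<ge> N \<Longrightarrow> n \<ge> N \<Longrightarrow> dist (X m) (X n) < e / 2"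
      using metric_CauchyD[OF \<open>Cauchy X\<close>, of "e / 2"] by auto
    have "dist (X n) (Abs_ell2 f) < e" if "n \<ge> N" for n
    proof -
      have "norm (Abs_ell2 (\<lambda>i. coord (X n) i - f i)) \<le> e / 2"
        by (rule ell2_boundI(2)) (use close[OF N that] \<open>0 < e\<close> in auto)
      moreover have "Abs_ell2 (\<lambda>i. coord (X n) i - f i) = X n - Abs_ell2 f"
        by (simp add: minus_ell2_def coord_Abs[OF f_summable])
      ultimately show ?thesis
        using \<open>0 < e\<close> by (simp add: dist_norm)
    qed
    then show "\<exists>N. \<forall>n\<ge>N. dist (X n) (Abs_ell2 f) < e" by blast
  qed
  then show "convergent X" by (auto simp: convergent_def)
qed

definition scaleC :: "complex \<Rightarrow> 'a ell2 \<Rightarrow> 'a ell2" (infixr \<open>*\<^sub>C\<close> 75) where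
  "c *\<^sub>C x = Abs_ell2 (\<lambda>i. c * coord x i)"

lemma coord_scaleC [simp]: "coord (c *\<^sub>C x) i = c * coord x i"
  by (simp only: scaleC_def coord_Abs square_summable_scale coord_summable)

definition ell2_basis :: "'a \<Rightarrow> 'a ell2" where
  "ell2_basis i = Abs_ell2 (\<lambda>j. if j = i then 1 else 0)"

lemma coord_basis [simp]: "coord (ell2_basis i) j = (if j = i then 1 else 0)"
proof -
  have "(\<lambda>j. (cmod (if j = i then 1 else 0))\<^sup>2) summable_on UNIV"
    by (rule finite_nonzero_values_imp_summable_on) (simp add: if_distrib cong: if_cong)
  then show ?thesis
    by (simp add: ell2_basis_def coord_Abs)
qed

lemma coord_sum [simp]: "coord (\<Sum>k\<in>F. g k) i = (\<Sum>k\<in>F. coord (g k) i)"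
  by (induction F rule: infinite_finite_induct) auto

lemma ell2_basis_expansion: "((\<lambda>i. coord x i *\<^sub>C ell2_basis i) has_sum x) UNIV"
  unfolding has_sum_def tendsto_iff eventually_finite_subsets_at_top
proof (intro allI impI)
  fix e :: real assume "0 < e"
  have "((\<lambda>i. (cmod (coord x i))\<^sup>2) has_sum (norm x)\<^sup>2) UNIV"
    unfolding norm_ell2_square by (rule has_sum_infsum[OF coord_summable])
  from this[unfolded has_sum_def tendsto_iff eventually_finite_subsets_at_top, rule_format, of "e\<^sup>2"] \<open>0 < e\<close>
  obtain F0 where F0: "finite F0"
    "\<And>F. finite F \<Longrightarrow> F0 \<subseteq> F \<Longrightarrow> dist (\<Sum>i\<in>F. (cmod (coord x i))\<^sup>2) ((norm x)\<^sup>2) < e\<^sup>2"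
    by auto
  have "dist (\<Sum>i\<in>F. coord x i *\<^sub>C ell2_basis i) x < e" if F: "finite F" "F0 \<subseteq> F" for F
  proof -
    define y where "y = x - (\<Sum>i\<in>F. coord x i *\<^sub>C ell2_basis i)"
    have y: "coord y i = (if i \<in> F then 0 else coord x i)" for i
      using F(1) by (simp add: y_def if_distrib sum.If_cases cong: if_cong)
    have "((\<lambda>i. (cmod (coord x i))\<^sup>2) has_sum ((norm x)\<^sup>2 - (\<Sum>i\<in>F. (cmod (coord x i))\<^sup>2))) (UNIV - F)"
      unfolding norm_ell2_square
      by (intro has_sum_Diff has_sum_infsum coord_summable has_sum_finite F(1)) simp
    then have "((\<lambda>i. (cmod (coord y i))\<^sup>2) has_sum ((norm x)\<^sup>2 - (\<Sum>i\<in>F. (cmod (coord x i))\<^sup>2))) UNIV"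
      by (rule has_sum_cong_neutral[THEN iffD1, rotated -1]) (auto simp: y)
    then have "(norm y)\<^sup>2 = (norm x)\<^sup>2 - (\<Sum>i\<in>F. (cmod (coord x i))\<^sup>2)"
      unfolding norm_ell2_square[of y] by (rule infsumI)
    also have "\<dots> < e\<^sup>2"
      using F0(2)[OF F] by (simp add: dist_real_def abs_if split: if_splits)
    finally have "norm y < e"
      by (rule power2_less_imp_less) (use \<open>0 < e\<close> in simp)
    then show ?thesis
      by (simp add: y_def dist_norm norm_minus_commute)
  qed
  with F0(1) show "\<exists>X. finite X \<and> X \<subseteq> UNIV \<and> (\<forall>Y. finite Y \<and> X \<subseteq> Y \<and> Y \<subseteq> UNIV \<longrightarrow>
      dist (\<Sum>i\<in>Y. coord x i *\<^sub>C ell2_basis i) x < e)"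
    by (intro exI[of _ F0]) auto
qed

section \<open>Bounded operators and point spectrum\<close>

definition bounded_clinear :: "('a ell2 \<Rightarrow> 'b ell2) \<Rightarrow> bool" where
  "bounded_clinear T \<longleftrightarrow> bounded_linear T \<and> (\<forall>c x. T (c *\<^sub>C x) = c *\<^sub>C T x)"

text \<open>The point spectrum of an operator \<open>T\<close> whose domain is the subspace \<open>V\<close>.\<close>

definition point_spectrum :: "'a ell2 set \<Rightarrow> ('a ell2 \<Rightarrow> 'a ell2) \<Rightarrow> complex set" where
  "point_spectrum V T = {c. \<exists>x\<in>V. x \<noteq> 0 \<and> T x = c *\<^sub>C x}"

lemma bounded_clinear_eqI:
  assumes "bounded_clinear S" "bounded_clinear T"
    and "\<And>i. S (ell2_basis i) = T (ell2_basis i)"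
  shows "S = T"
proof
  fix x
  have "((\<lambda>i. S (coord x i *\<^sub>C ell2_basis i)) has_sum S x) UNIV"
    using assms(1) has_sum_bounded_linear[OF _ ell2_basis_expansion]
    unfolding bounded_clinear_def by blast
  moreover have "((\<lambda>i. T (coord x i *\<^sub>C ell2_basis i)) has_sum T x) UNIV"
    using assms(2) has_sum_bounded_linear[OF _ ell2_basis_expansion]
    unfolding bounded_clinear_def by blast
  moreover have "(\<lambda>i. S (coord x i *\<^sub>C ell2_basis i)) = (\<lambda>i. T (coord x i *\<^sub>C ell2_basis i))"
    using assms by (simp add: bounded_clinear_def)
  ultimately show "S x = T x"
    using has_sum_unique by metis
qed

section \<open>Tensor products\<close>

text \<open>
  The Hilbert space tensor product of \<open>\<ell>\<^sup>2(I)\<close> and \<open>\<ell>\<^sup>2(J)\<close> is realised as \<open>\<ell>\<^sup>2(I \<times> J)\<close>, with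
  \<open>(u \<otimes> v)(i, j) = u(i) v(j)\<close>. The lemmas \<open>cinner_tensor\<close> and \<open>closure_span_tensor\<close> (together with
  bilinearity and completeness) are the properties that characterise the Hilbert space tensor
  product up to unitary isomorphism.
\<close>

definition tensor :: "'a ell2 \<Rightarrow> 'b ell2 \<Rightarrow> ('a \<times> 'b) ell2" (infixr \<open>\<otimes>\<close> 70) where
  "u \<otimes> v = Abs_ell2 (\<lambda>(i, j). coord u i * coord v j)"

lemma coord_tensor [simp]: "coord (u \<otimes> v) (i, j) = coord u i * coord v j"
proof -
  have "(\<lambda>(i, j). (cmod (coord u i))\<^sup>2 * (cmod (coord v j))\<^sup>2) summable_on UNIV \<times> UNIV"
  proof (rule summable_on_SigmaI)
    show "((\<lambda>j. case (i, j) of (i, j) \<Rightarrow> (cmod (coord u i))\<^sup>2 * (cmod (coord v j))\<^sup>2)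
            has_sum (cmod (coord u i))\<^sup>2 * (norm v)\<^sup>2) UNIV" for i
      unfolding norm_ell2_square prod.case
      by (intro has_sum_cmult_right has_sum_infsum coord_summable)
    show "(\<lambda>i. (cmod (coord u i))\<^sup>2 * (norm v)\<^sup>2) summable_on UNIV"
      by (intro summable_on_cmult_left coord_summable)
  qed auto
  then have "(\<lambda>p. (cmod (case p of (i, j) \<Rightarrow> coord u i * coord v j))\<^sup>2) summable_on UNIV"
    by (simp add: case_prod_unfold norm_mult power_mult_distrib)
  then show ?thesis
    by (simp add: tensor_def coord_Abs)
qed

lemma tensor_add_left: "(u + u') \<otimes> v = u \<otimes> v + u' \<otimes> v"
  and tensor_add_right: "u \<otimes> (v + v') = u \<otimes> v + u \<otimes> v'"
  and tensor_scaleC_left: "(c *\<^sub>C u) \<otimes> v = c *\<^sub>C (u \<otimes> v)"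
  and tensor_scaleC_right: "u \<otimes> (c *\<^sub>C v) = c *\<^sub>C (u \<otimes> v)"
  by (rule ell2_eqI; clarsimp simp: algebra_simps)+

lemma tensor_basis: "ell2_basis i \<otimes> ell2_basis j = ell2_basis (i, j)"
  by (rule ell2_eqI) (auto split: if_splits)

lemma cinner_tensor: "cinner (u \<otimes> v) (u' \<otimes> v') = cinner u u' * cinner v v'"
proof -
  have "cinner (u \<otimes> v) (u' \<otimes> v') =
      (\<Sum>\<^sub>\<infinity>p\<in>UNIV \<times> UNIV. coord (u \<otimes> v) p * cnj (coord (u' \<otimes> v') p))"
    by (simp add: cinner_def)
  also have "\<dots> = (\<Sum>\<^sub>\<infinity>i. \<Sum>\<^sub>\<infinity>j. coord (u \<otimes> v) (i, j) * cnj (coord (u' \<otimes> v') (i, j)))"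
    by (rule infsum_Sigma_banach[symmetric]) (simp add: cinner_summable)
  also have "\<dots> = (\<Sum>\<^sub>\<infinity>i. (coord u i * cnj (coord u' i)) * cinner v v')"
    unfolding cinner_def by (simp add: infsum_cmult_right'[symmetric] mult_ac)
  also have "\<dots> = cinner u u' * cinner v v'"
    unfolding cinner_def by (rule infsum_cmult_left')
  finally show ?thesis .
qed

lemma closure_span_tensor: "closure (span {u \<otimes> v |u v. True}) = UNIV"
proof -
  have "x \<in> closure (span {u \<otimes> v |u v. True})" for x :: "('a \<times> 'b) ell2"
  proof (rule Lim_in_closed_set)
    show "((\<lambda>F. \<Sum>p\<in>F. coord x p *\<^sub>C ell2_basis p) \<longlongrightarrow> x) (finite_subsets_at_top UNIV)"
      using ell2_basis_expansion[of x] by (simp add: has_sum_def)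
    have "coord x (i, j) *\<^sub>C ell2_basis (i, j) = (coord x (i, j) *\<^sub>C ell2_basis i) \<otimes> ell2_basis j" for i j
      by (simp add: tensor_scaleC_left tensor_basis)
    then have "coord x p *\<^sub>C ell2_basis p \<in> span {u \<otimes> v |u v. True}" for p
      by (cases p) (auto intro!: span_base)
    then show "\<forall>\<^sub>F F in finite_subsets_at_top UNIV.
        (\<Sum>p\<in>F. coord x p *\<^sub>C ell2_basis p) \<in> closure (span {u \<otimes> v |u v. True})"
      by (intro always_eventually allI subsetD[OF closure_subset] span_sum)
  qed auto
  then show ?thesis by auto
qed

definition tensor_flip :: "('a \<times> 'a) ell2 \<Rightarrow> ('a \<times> 'a) ell2" where
  "tensor_flip = (THE F. bounded_clinear F \<and> (\<forall>u v. F (u \<otimes> v) = v \<otimes> u))"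

definition tensor_op ::
    "('a ell2 \<Rightarrow> 'a ell2) \<Rightarrow> ('b ell2 \<Rightarrow> 'b ell2) \<Rightarrow> ('a \<times> 'b) ell2 \<Rightarrow> ('a \<times> 'b) ell2"
    (infixr \<open>\<otimes>\<^sub>o\<close> 70) where
  "A \<otimes>\<^sub>o B = (THE T. bounded_clinear T \<and> (\<forall>u v. T (u \<otimes> v) = A u \<otimes> B v))"

definition sym_square :: "('a \<times> 'a) ell2 set" where
  "sym_square = {x. tensor_flip x = x}"

definition sym_tensor_op ::
    "('a ell2 \<Rightarrow> 'a ell2) \<Rightarrow> ('a ell2 \<Rightarrow> 'a ell2) \<Rightarrow> ('a \<times> 'a) ell2 \<Rightarrow> ('a \<times> 'a) ell2"
    (infixr \<open>\<odot>\<close> 70) where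
  "A \<odot> B = restrict (\<lambda>x. (1/2) *\<^sub>C ((A \<otimes>\<^sub>o B) x + (B \<otimes>\<^sub>o A) x)) sym_square"

text \<open>The two definite descriptions above are well defined.\<close>

lemma tensor_determined:
  assumes "bounded_clinear S" "bounded_clinear T" "\<And>u v. S (u \<otimes> v) = T (u \<otimes> v)"
  shows "S = T"
  by (rule bounded_clinear_eqI[OF assms(1,2)]) (metis assms(3) surj_pair tensor_basis)

definition swap_vec :: "('a \<times> 'b) ell2 \<Rightarrow> ('b \<times> 'a) ell2" where
  "swap_vec x = Abs_ell2 (\<lambda>(i, j). coord x (j, i))"

lemma coord_swap_vec [simp]: "coord (swap_vec x) (i, j) = coord x (j, i)"
proof -
  have "(\<lambda>p. (cmod (coord x (prod.swap p)))\<^sup>2) summable_on UNIV"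
    using summable_on_reindex_bij_betw[OF bij_swap, of "\<lambda>p. (cmod (coord x p))\<^sup>2"]
    by (simp add: coord_summable)
  then show ?thesis
    by (simp add: swap_vec_def coord_Abs case_prod_unfold prod.swap_def)
qed

lemma norm_swap_vec: "norm (swap_vec x) = norm x"
proof -
  have "coord (swap_vec x) p = coord x (prod.swap p)" for p
    by (cases p) simp
  then have "(norm (swap_vec x))\<^sup>2 = (norm x)\<^sup>2"
    unfolding norm_ell2_square
    using infsum_reindex_bij_betw[OF bij_swap, of "\<lambda>p. (cmod (coord x p))\<^sup>2"] by simp
  then show ?thesis by simp
qed

lemma bounded_clinear_swap_vec: "bounded_clinear swap_vec"
  unfolding bounded_clinear_def
proof (intro conjI allI bounded_linear_intro[where K = 1])
  show "norm (swap_vec x) \<le> norm x * 1" for x :: "('a \<times> 'b) ell2"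
    by (simp add: norm_swap_vec)
qed (rule ell2_eqI; clarsimp)+

lemma swap_vec_tensor: "swap_vec (u \<otimes> v) = v \<otimes> u"
  by (rule ell2_eqI) clarsimp

lemma tensor_flip_ex1: "\<exists>!F. bounded_clinear F \<and> (\<forall>u v :: 'a ell2. F (u \<otimes> v) = v \<otimes> u)"
proof (rule ex1I[of _ swap_vec])
  show "bounded_clinear swap_vec \<and> (\<forall>u v :: 'a ell2. swap_vec (u \<otimes> v) = v \<otimes> u)"
    by (simp add: bounded_clinear_swap_vec swap_vec_tensor)
qed (auto intro!: tensor_determined bounded_clinear_swap_vec simp: swap_vec_tensor)

lemma tensor_flip_eq: "tensor_flip = swap_vec"
  unfolding tensor_flip_def
  by (rule the1_equality[OF tensor_flip_ex1])
    (simp add: bounded_clinear_swap_vec swap_vec_tensor)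

definition slice :: "('a \<times> 'b) ell2 \<Rightarrow> 'a \<Rightarrow> 'b ell2" where
  "slice x i = Abs_ell2 (\<lambda>j. coord x (i, j))"

lemma slice_summable: "(\<lambda>j. (cmod (coord x (i, j)))\<^sup>2) summable_on UNIV"
  by (rule summable_on_SigmaD1[of "\<lambda>i j. (cmod (coord x (i, j)))\<^sup>2" UNIV "\<lambda>_. UNIV"])
    (simp_all add: case_prod_unfold coord_summable)

lemma coord_slice [simp]: "coord (slice x i) j = coord x (i, j)"
  by (simp add: slice_def coord_Abs slice_summable)

lemma has_sum_norm_slice: "((\<lambda>i. (norm (slice x i))\<^sup>2) has_sum (norm x)\<^sup>2) UNIV"
proof (rule has_sum_SigmaD)
  show "((\<lambda>p. (cmod (coord x p))\<^sup>2) has_sum (norm x)\<^sup>2) (Sigma UNIV (\<lambda>_. UNIV))"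
    unfolding norm_ell2_square by (simp add: coord_summable)
  show "((\<lambda>j. (cmod (coord x (i, j)))\<^sup>2) has_sum (norm (slice x i))\<^sup>2) UNIV" for i
    unfolding norm_ell2_square by (simp add: slice_summable)
qed

definition apply_right :: "('b ell2 \<Rightarrow> 'c ell2) \<Rightarrow> ('a \<times> 'b) ell2 \<Rightarrow> ('a \<times> 'c) ell2" where
  "apply_right B x = Abs_ell2 (\<lambda>(i, j). coord (B (slice x i)) j)"

lemma apply_right:
  fixes B :: "'b ell2 \<Rightarrow> 'c ell2" and x :: "('a \<times> 'b) ell2" and u :: "'a ell2"
  assumes "bounded_clinear B"
  shows coord_apply_right: "coord (apply_right B x) (i, j) = coord (B (slice x i)) j"
    and bounded_clinear_apply_right: "bounded_clinear (apply_right B :: ('a \<times> 'b) ell2 \<Rightarrow> _)"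
    and apply_right_tensor: "apply_right B (u \<otimes> v) = u \<otimes> B v"
proof -
  interpret B: bounded_linear B
    using assms by (simp add: bounded_clinear_def)
  have B_scaleC: "B (c *\<^sub>C y) = c *\<^sub>C B y" for c y
    using assms by (simp add: bounded_clinear_def)
  obtain K where K: "0 \<le> K" "\<And>y. norm (B y) \<le> norm y * K"
    using B.nonneg_bounded by blast
  have K2: "(norm (B y))\<^sup>2 \<le> K\<^sup>2 * (norm y)\<^sup>2" for y
    using power_mono[OF K(2)[of y] norm_ge_zero, of 2] by (simp add: power_mult_distrib mult_ac)
  have bd_summable: "(\<lambda>i. K\<^sup>2 * (norm (slice x i))\<^sup>2) summable_on UNIV" for x :: "('a \<times> 'b) ell2"
    by (intro summable_on_cmult_right has_sum_imp_summable[OF has_sum_norm_slice])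
  have norm_summable: "(\<lambda>i. (norm (B (slice x i)))\<^sup>2) summable_on UNIV" for x :: "('a \<times> 'b) ell2"
    by (rule summable_on_comparison_test[OF bd_summable]) (use K2 in auto)
  have "(\<lambda>p. (cmod (case p of (i, j) \<Rightarrow> coord (B (slice x i)) j))\<^sup>2) summable_on UNIV \<times> UNIV"
    for x :: "('a \<times> 'b) ell2"
  proof (rule summable_on_SigmaI[OF _ norm_summable])
    show "((\<lambda>j. (cmod (case (i, j) of (i, j) \<Rightarrow> coord (B (slice x i)) j))\<^sup>2)
        has_sum (norm (B (slice x i)))\<^sup>2) UNIV" for i
      unfolding norm_ell2_square prod.case by (rule has_sum_infsum[OF coord_summable])
  qed simp
  then have *: "coord (apply_right B x) (i, j) = coord (B (slice x i)) j" for x :: "('a \<times> 'b) ell2" and i j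
    by (simp add: apply_right_def coord_Abs)
  then show "coord (apply_right B x) (i, j) = coord (B (slice x i)) j" .
  have slice_eq: "slice (apply_right B x) i = B (slice x i)" for x :: "('a \<times> 'b) ell2" and i
    by (rule ell2_eqI) (simp add: *)
  have bound: "norm (apply_right B x) \<le> norm x * K" for x :: "('a \<times> 'b) ell2"
  proof (rule power2_le_imp_le)
    have "(norm (apply_right B x))\<^sup>2 \<le> K\<^sup>2 * (norm x)\<^sup>2"
      using has_sum_norm_slice[of "apply_right B x"]
    proof (rule has_sum_mono)
      show "((\<lambda>i. K\<^sup>2 * (norm (slice x i))\<^sup>2) has_sum K\<^sup>2 * (norm x)\<^sup>2) UNIV"
        by (intro has_sum_cmult_right has_sum_norm_slice)
    qed (simp add: slice_eq K2)
    then show "(norm (apply_right B x))\<^sup>2 \<le> (norm x * K)\<^sup>2"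
      by (simp add: power_mult_distrib mult_ac)
  qed (use K(1) in simp)
  have slice_add: "slice (x + y) i = slice x i + slice y i"
    and slice_scaleR: "slice (r *\<^sub>R x) i = r *\<^sub>R slice x i"
    and slice_scaleC: "slice (c *\<^sub>C x) i = c *\<^sub>C slice x i" for x y :: "('a \<times> 'b) ell2" and r c i
    by (rule ell2_eqI; simp)+
  show "bounded_clinear (apply_right B :: ('a \<times> 'b) ell2 \<Rightarrow> _)"
    unfolding bounded_clinear_def
    by (intro conjI allI bounded_linear_intro[OF _ _ bound])
      (rule ell2_eqI; clarsimp simp: * slice_add slice_scaleR slice_scaleC B.add B.scaleR B_scaleC)+
  have "slice (u \<otimes> v) i = coord u i *\<^sub>C v" for i
    by (rule ell2_eqI) simp
  then show "apply_right B (u \<otimes> v) = u \<otimes> B v"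
    by (intro ell2_eqI) (clarsimp simp: * B_scaleC)
qed

lemma bounded_clinear_compose:
  "bounded_clinear S \<Longrightarrow> bounded_clinear T \<Longrightarrow> bounded_clinear (\<lambda>x. S (T x))"
  by (simp add: bounded_clinear_def bounded_linear_compose)

lemma tensor_op_ex1:
  assumes "bounded_clinear A" "bounded_clinear B"
  shows "\<exists>!T. bounded_clinear T \<and> (\<forall>u v. T (u \<otimes> v) = A u \<otimes> B v)"
proof (rule ex_ex1I)
  let ?T = "\<lambda>x. swap_vec (apply_right A (swap_vec (apply_right B x)))"
  have "bounded_clinear ?T"
    by (rule bounded_clinear_compose[OF bounded_clinear_swap_vec
          bounded_clinear_compose[OF bounded_clinear_apply_right[OF assms(1)]
          bounded_clinear_compose[OF bounded_clinear_swap_vec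
          bounded_clinear_apply_right[OF assms(2)]]]])
  moreover have "?T (u \<otimes> v) = A u \<otimes> B v" for u v
    by (simp add: apply_right_tensor assms swap_vec_tensor)
  ultimately show "\<exists>T. bounded_clinear T \<and> (\<forall>u v. T (u \<otimes> v) = A u \<otimes> B v)" by blast
qed (auto intro: tensor_determined)

lemma
  assumes "bounded_clinear A" "bounded_clinear B"
  shows bounded_clinear_tensor_op: "bounded_clinear (A \<otimes>\<^sub>o B)"
    and tensor_op_tensor: "(A \<otimes>\<^sub>o B) (u \<otimes> v) = A u \<otimes> B v"
  using theI'[OF tensor_op_ex1[OF assms]] unfolding tensor_op_def by blast+

lemma sym_tensor_op_invariant:
  assumes "bounded_clinear A" "bounded_clinear B" "x \<in> sym_square"
  shows "(A \<odot> B) x \<in> sym_square"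
proof -
  have AB: "tensor_flip ((A \<otimes>\<^sub>o B) x) = (B \<otimes>\<^sub>o A) (tensor_flip x)"
    if "bounded_clinear A" "bounded_clinear B" for A B :: "'a ell2 \<Rightarrow> 'a ell2" and x
  proof -
    have "(\<lambda>x. tensor_flip ((A \<otimes>\<^sub>o B) x)) = (\<lambda>x. (B \<otimes>\<^sub>o A) (tensor_flip x))"
      unfolding tensor_flip_eq
      by (rule tensor_determined[OF
            bounded_clinear_compose[OF bounded_clinear_swap_vec bounded_clinear_tensor_op[OF that]]
            bounded_clinear_compose[OF bounded_clinear_tensor_op[OF that(2,1)] bounded_clinear_swap_vec]])
        (simp add: swap_vec_tensor tensor_op_tensor that)
    then show ?thesis by (rule fun_cong)
  qed
  have "tensor_flip (c *\<^sub>C y) = c *\<^sub>C tensor_flip y"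
    and "tensor_flip (y + z) = tensor_flip y + tensor_flip z" for c and y z :: "('a \<times> 'a) ell2"
    by (rule ell2_eqI; clarsimp simp: tensor_flip_eq)+
  then show ?thesis
    using assms(3) by (simp add: sym_square_def sym_tensor_op_def AB assms(1,2) add.commute)
qed

end

theory Submission
  imports Defs
begin

text \<open>
  If \<open>\<mu>\<^sub>k = 0\<close>, the kernel contains \<open>e\<^sub>k \<otimes> e\<^sub>k\<close>. In coordinates, with \<open>\<alpha>\<^sub>-\<^sub>1 = 0\<close>, twice the
  \<open>(i, j)\<close> entry of \<open>(S \<odot> M) x\<close> is \<open>\<alpha>\<^sub>i\<^sub>-\<^sub>1 \<mu>\<^sub>j x(i - 1, j) + \<mu>\<^sub>i \<alpha>\<^sub>j\<^sub>-\<^sub>1 x(i, j - 1)\<close>. If no \<open>\<mu>\<^sub>i\<close>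
  vanishes, these entries determine the columns of \<open>x\<close> one after the other. If
  \<open>(S \<odot> M) x = c x\<close> with \<open>c \<noteq> 0\<close>, then each antidiagonal of \<open>x\<close> is determined by the preceding
  one, so \<open>x = 0\<close>.
\<close>

lemma bounded_linear_coord: "bounded_linear (\<lambda>x. coord x p)"
  by (rule bounded_linear_intro[where K = 1]) (simp_all add: coord_le_norm scaleR_conv_of_real)

text \<open>Taking the coordinate at \<open>p\<close> after \<open>T\<close> is bounded and linear,
  so it may be applied termwise to the basis expansion of \<open>x\<close>.\<close>

lemma bounded_clinear_coord_has_sum:
  assumes "bounded_clinear T"
  shows "((\<lambda>q. coord x q * coord (T (ell2_basis q)) p) has_sum coord (T x) p) UNIV"
proof -
  have "bounded_linear (\<lambda>x. coord (T x) p)"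
    using assms by (intro bounded_linear_compose[OF bounded_linear_coord])
      (simp add: bounded_clinear_def)
  from has_sum_bounded_linear[OF this ell2_basis_expansion[of x]]
  show ?thesis
    using assms by (simp add: bounded_clinear_def)
qed

text \<open>Meant for weighted shifts, whose matrix has at most one nonzero entry in each row: the
  expansion then collapses to one term.\<close>

lemma bounded_clinear_coord_single:
  assumes "bounded_clinear T"
    and "\<And>q. q \<noteq> q0 \<Longrightarrow> coord (T (ell2_basis q)) p = 0"
  shows "coord (T x) p = coord x q0 * coord (T (ell2_basis q0)) p"
proof -
  have "((\<lambda>q. coord x q * coord (T (ell2_basis q)) p) has_sum
      coord x q0 * coord (T (ell2_basis q0)) p) {q0}"
    using has_sum_finite[of "{q0}"] by fastforce
  then have "((\<lambda>q. coord x q * coord (T (ell2_basis q)) p) has_sum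
      coord x q0 * coord (T (ell2_basis q0)) p) UNIV"
    by (rule has_sum_cong_neutral[THEN iffD1, rotated -1]) (auto simp: assms(2))
  with bounded_clinear_coord_has_sum[OF assms(1)] show ?thesis
    by (rule has_sum_unique)
qed

locale shift_diagonal =
  fixes \<alpha> \<mu> :: "nat \<Rightarrow> complex"
    and S M :: "nat ell2 \<Rightarrow> nat ell2"
  assumes S: "bounded_clinear S" "\<And>i. S (ell2_basis i) = \<alpha> i *\<^sub>C ell2_basis (Suc i)"
    and M: "bounded_clinear M" "\<And>i. M (ell2_basis i) = \<mu> i *\<^sub>C ell2_basis i"
begin

lemma shift_tensor_basis:
  "(S \<otimes>\<^sub>o M) (ell2_basis (a, b)) = (\<alpha> a * \<mu> b) *\<^sub>C ell2_basis (Suc a, b)"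
  "(M \<otimes>\<^sub>o S) (ell2_basis (a, b)) = (\<mu> a * \<alpha> b) *\<^sub>C ell2_basis (a, Suc b)"
  unfolding tensor_basis[symmetric]
  by (rule ell2_eqI; simp add: tensor_op_tensor S M tensor_scaleC_left tensor_scaleC_right)+

lemma coord_shift_tensor:
  "coord ((S \<otimes>\<^sub>o M) x) (i, j) = (case i of 0 \<Rightarrow> 0 | Suc a \<Rightarrow> \<alpha> a * \<mu> j * coord x (a, j))"
  \<comment> \<open>For \<open>i = 0\<close> the truncated \<open>i - 1\<close> is \<open>0\<close>;
    the vector at \<open>(0, j)\<close> is sent to a multiple of the one at \<open>(1, j)\<close>,
    so the entry is zero, as the case split demands.\<close>
  by (subst bounded_clinear_coord_single[OF bounded_clinear_tensor_op[OF S(1) M(1)], of "(i - 1, j)"])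
    (auto simp: shift_tensor_basis split: nat.split if_splits)

lemma coord_tensor_shift:
  "coord ((M \<otimes>\<^sub>o S) x) (i, j) = (case j of 0 \<Rightarrow> 0 | Suc b \<Rightarrow> \<mu> i * \<alpha> b * coord x (i, b))"
  by (subst bounded_clinear_coord_single[OF bounded_clinear_tensor_op[OF M(1) S(1)], of "(i, j - 1)"])
    (auto simp: shift_tensor_basis split: nat.split if_splits)

lemma coord_sym_tensor:
  assumes "x \<in> sym_square"
  shows "2 * coord ((S \<odot> M) x) (i, j) =
      (case i of 0 \<Rightarrow> 0 | Suc a \<Rightarrow> \<alpha> a * \<mu> j * coord x (a, j)) +
      (case j of 0 \<Rightarrow> 0 | Suc b \<Rightarrow> \<mu> i * \<alpha> b * coord x (i, b))"
  using assms by (simp add: sym_tensor_op_def coord_shift_tensor coord_tensor_shift)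

lemma zero_in_point_spectrum:
  assumes "\<mu> k = 0"
  shows "0 \<in> point_spectrum sym_square (S \<odot> M)"
proof -
  let ?x = "ell2_basis (k, k) :: (nat \<times> nat) ell2"
  have sym: "?x \<in> sym_square"
    unfolding sym_square_def tensor_flip_eq
    by (simp add: swap_vec_tensor flip: tensor_basis)
  have "coord ?x (k, k) \<noteq> coord 0 (k, k)"
    by simp
  then have "?x \<noteq> 0"
    by metis
  \<comment> \<open>Each of the two tensor terms carries the factor \<open>\<mu> k\<close>.\<close>
  moreover have "(S \<odot> M) ?x = 0 *\<^sub>C ?x"
    using sym by (intro ell2_eqI) (simp add: sym_tensor_op_def shift_tensor_basis assms)
  ultimately show ?thesis
    using sym unfolding point_spectrum_def by blast
qed

lemma inj_on_sym_tensor: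
  assumes "\<And>i. \<alpha> i \<noteq> 0" "\<And>i. \<mu> i \<noteq> 0"
  shows "inj_on (S \<odot> M) sym_square"
proof (rule inj_onI)
  fix x y
  assume xy: "x \<in> sym_square" "y \<in> sym_square" "(S \<odot> M) x = (S \<odot> M) y"
  have "coord x (i, j) = coord y (i, j)" for i j
  proof (induction j arbitrary: i)
    case 0
    \<comment> \<open>At entry \<open>(Suc i, 0)\<close> only the term in \<open>x(i, 0)\<close>
      survives, with nonzero coefficient.\<close>
    show ?case
      using coord_sym_tensor[OF xy(1), of "Suc i" 0] coord_sym_tensor[OF xy(2), of "Suc i" 0] xy(3)
      by (simp add: assms)
  next
    case (Suc j)
    \<comment> \<open>Entry \<open>(Suc i, Suc j)\<close> couples the unknown
      \<open>x(i, Suc j)\<close> with \<open>x(Suc i, j)\<close> from the previous column; this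
      shift of row is why \<open>i\<close> is kept arbitrary.\<close>
    show ?case
      using coord_sym_tensor[OF xy(1), of "Suc i" "Suc j"]
        coord_sym_tensor[OF xy(2), of "Suc i" "Suc j"] xy(3) Suc.IH[of "Suc i"]
      by (simp add: assms)
  qed
  then show "x = y"
    by (intro ell2_eqI) auto
qed

lemma point_spectrum_sym_tensor: "point_spectrum sym_square (S \<odot> M) \<subseteq> {0}"
proof
  fix c
  assume "c \<in> point_spectrum sym_square (S \<odot> M)"
  then obtain x where x: "x \<in> sym_square" "x \<noteq> 0" "(S \<odot> M) x = c *\<^sub>C x"
    unfolding point_spectrum_def by blast
  have "coord x (i, j) = 0" if "c \<noteq> 0" for i j
  proof (induction "i + j" arbitrary: i j rule: less_induct)
    case less
    \<comment> \<open>The right-hand side involves only \<open>(i - 1, j)\<close> and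
      \<open>(i, j - 1)\<close>, where induction applies; on the border the missing terms are zero,
      so \<open>(0, 0)\<close> needs no separate base case.\<close>
    have "2 * (c * coord x (i, j)) = 0"
      using coord_sym_tensor[OF x(1), of i j] less
      by (simp add: x(3) split: nat.split)
    with that show ?case
      by simp
  qed
  then have "x = 0" if "c \<noteq> 0"
    using that by (intro ell2_eqI) auto
  with x(2) show "c \<in> {0}"
    by blast
qed

end

theorem theorem4p1:
  fixes \<alpha> \<mu> :: "nat \<Rightarrow> complex"
    and S M :: "nat ell2 \<Rightarrow> nat ell2"
  assumes "bounded (range \<alpha>)"
    and "bounded_clinear S" and "\<And>i. S (ell2_basis i) = \<alpha> i *\<^sub>C ell2_basis (Suc i)"
    and "bounded (range \<mu>)"
    and "bounded_clinear M" and "\<And>i. M (ell2_basis i) = \<mu> i *\<^sub>C ell2_basis i"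
    and "\<And>i. \<alpha> i \<noteq> 0"
  shows "((\<exists>i. \<mu> i = 0) \<longrightarrow> 0 \<in> point_spectrum sym_square (S \<odot> M))
       \<and> ((\<nexists>i. \<mu> i = 0) \<longrightarrow> inj_on (S \<odot> M) sym_square)
       \<and> point_spectrum sym_square (S \<odot> M) \<subseteq> {0}"
proof -
  interpret shift_diagonal \<alpha> \<mu> S M
    by unfold_locales (fact assms)+
  show ?thesis
    using zero_in_point_spectrum inj_on_sym_tensor point_spectrum_sym_tensor assms(7) by blast
qed

end
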